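(* Let $S$ be a finite multiplicatively idempotent congruence-simple semiring. Then $S$ is isomorphic to one of the eight semirings $\mathbb{S}_1,\dots,\mathbb{S}_8$ (defined in the context; $\mathbb{S}_1,\dots,\mathbb{S}_6$ have two elements and $\mathbb{S}_7,\mathbb{S}_8$ have three elements).
   Context: A semiring $S(+,\cdot)$ is a non-empty set with two associative binary operations such that the addition is commutative and the multiplication distributes over the addition from both sides (no zero or unity is assumed, and multiplication need not be commutative). It is multiplicatively idempotent if $x\cdot x=x$ for all $x\in S$. A congruence is an equivalence relation on $S$ compatible with both operations. $S$ is congruence-simple if it has exactly two congruences (namely $id_S$ and $S\times S$, so $|S|\ge 2$). The semirings $\mathbb{S}_1,\mathbb{S}_2,\mathbb{S}_3,\mathbb{S}_4$ have underlying set $\{w,a\}$ with $w\neq a$, the multiplication $w\cdot w=w\cdot a=a\cdot w=w$, $a\cdot a=a$, and the following additions: $\mathbb{S}_1$: $w+w=w$, $w+a=a+w=a$, $a+a=w$; $\mathbb{S}_2$: $w+w=w$, $w+a=a+w=a$, $a+a=a$; $\mathbb{S}_3$: $w+w=w$, $w+a=a+w=w$, $a+a=a$; $\mathbb{S}_4$: $w+w=w+a=a+w=a+a=w$. The semirings $\mathbb{S}_5,\mathbb{S}_6$ have underlying set $\{a,w\}$ with $a\ne w$, the addition $a+a=a$, $a+w=w+a=w+w=w$, and the following multiplications: $\mathbb{S}_5$: $x\cdot y=x$ for all $x,y$; $\mathbb{S}_6$: $x\cdot y=y$ for all $x,y$. The semirings $\mathbb{S}_7,\mathbb{S}_8$ have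 underlying set $\{a,b,w\}$ (three distinct elements), the addition $x+y=\max(x,y)$ with respect to the linear order $a<b<w$, and the following multiplications: $\mathbb{S}_7$: $a\cdot x=a$, $b\cdot x=x$, $w\cdot x=w$ for all $x\in\{a,b,w\}$; $\mathbb{S}_8$: $x\cdot a=a$, $x\cdot b=x$, $x\cdot w=w$ for all $x\in\{a,b,w\}$. (Equivalently, $\mathbb{S}_7$ is the semiring $End(L)$ of all endomorphisms of the two-element semilattice $L=\{0,1\}$, $0<1$, with pointwise addition and composition as multiplication, where $a$ is the constant map $0$, $b$ is the identity and $w$ is the constant map $1$; and $\mathbb{S}_8=End(L)^{op}$ is the opposite semiring, with the order of multiplication reversed.) *)

theory Defs
  imports Main
begin

text \<open>
  The type class \<^class>\<open>semiring\<close> assumes neither a zero nor a unit, nor commutativity of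
  multiplication.
\<close>

definition semiring_congruence :: "('a::semiring \<times> 'a) set \<Rightarrow> bool" where
  "semiring_congruence r \<longleftrightarrow> equiv UNIV r \<and>
     (\<forall>x x' y y'. (x, x') \<in> r \<longrightarrow> (y, y') \<in> r \<longrightarrow> (x + y, x' + y') \<in> r \<and> (x * y, x' * y') \<in> r)"

definition congruence_simple :: "'a::semiring itself \<Rightarrow> bool" where
  "congruence_simple _ \<longleftrightarrow> card {r :: ('a \<times> 'a) set. semiring_congruence r} = 2"

definition semiring_iso :: "('a::semiring \<Rightarrow> 'b::semiring) \<Rightarrow> bool" where
  "semiring_iso f \<longleftrightarrow> bij f \<and> (\<forall>x y. f (x + y) = f x + f y \<and> f (x * y) = f x * f y)"

definition semiring_isomorphic :: "'a::semiring itself \<Rightarrow> 'b::semiring itself \<Rightarrow> bool" where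
  "semiring_isomorphic _ _ \<longleftrightarrow> (\<exists>f :: 'a \<Rightarrow> 'b. semiring_iso f)"

lemma semiring_congruence_Id: "semiring_congruence Id"
  by (auto simp: semiring_congruence_def equiv_def refl_on_def sym_def trans_def)

lemma semiring_congruence_UNIV: "semiring_congruence UNIV"
  by (auto simp: semiring_congruence_def equiv_def refl_on_def sym_def trans_def)

lemma congruence_simple_iff:
  "congruence_simple TYPE('a::semiring) \<longleftrightarrow>
     (\<exists>x y :: 'a. x \<noteq> y) \<and> (\<forall>r :: ('a \<times> 'a) set. semiring_congruence r \<longrightarrow> r = Id \<or> r = UNIV)"
proof -
  let ?C = "{r :: ('a \<times> 'a) set. semiring_congruence r}"
  have mem: "Id \<in> ?C" "UNIV \<in> ?C"
    using semiring_congruence_Id semiring_congruence_UNIV by auto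
  show ?thesis
  proof
    assume "congruence_simple TYPE('a)"
    then have "card ?C = 2" by (simp add: congruence_simple_def)
    then obtain r s where rs: "?C = {r, s}" "r \<noteq> s" by (auto simp: card_2_iff)
    show "(\<exists>x y :: 'a. x \<noteq> y) \<and>
        (\<forall>r :: ('a \<times> 'a) set. semiring_congruence r \<longrightarrow> r = Id \<or> r = UNIV)"
    proof (cases "\<exists>x y :: 'a. x \<noteq> y")
      case True
      then have "(Id :: ('a \<times> 'a) set) \<noteq> UNIV" by auto
      with mem rs have "?C = {Id, UNIV}" by auto
      with True show ?thesis by auto
    next
      case False
      then have all: "(x, x') \<in> t" if "t \<in> ?C" for x x' :: 'a and t
        using that by (metis (mono_tags, lifting) UNIV_I equiv_def mem_Collect_eq refl_onD
            semiring_congruence_def)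
      then have "t = UNIV" if "t \<in> ?C" for t using that by auto
      then have "r = UNIV" "s = UNIV" using rs(1) by auto
      with rs(2) show ?thesis by simp
    qed
  next
    assume *: "(\<exists>x y :: 'a. x \<noteq> y) \<and>
        (\<forall>r :: ('a \<times> 'a) set. semiring_congruence r \<longrightarrow> r = Id \<or> r = UNIV)"
    then have "(Id :: ('a \<times> 'a) set) \<noteq> UNIV" "?C = {Id, UNIV}"
      using mem by auto
    then show "congruence_simple TYPE('a)"
      by (simp add: congruence_simple_def)
  qed
qed

datatype S1 = W1 | A1

instantiation S1 :: semiring
begin

fun plus_S1 :: "S1 \<Rightarrow> S1 \<Rightarrow> S1" where
  "W1 + W1 = (W1 :: S1)" |
  "W1 + A1 = (A1 :: S1)" |
  "A1 + W1 = (A1 :: S1)" |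
  "A1 + A1 = (W1 :: S1)"

fun times_S1 :: "S1 \<Rightarrow> S1 \<Rightarrow> S1" where
  "W1 * W1 = (W1 :: S1)" |
  "W1 * A1 = (W1 :: S1)" |
  "A1 * W1 = (W1 :: S1)" |
  "A1 * A1 = (A1 :: S1)"

instance
proof
  fix x y z :: S1
  show "(x + y) + z = x + (y + z)"
    by (cases x; cases y; cases z) simp_all
  show "x + y = y + x"
    by (cases x; cases y) simp_all
  show "(x * y) * z = x * (y * z)"
    by (cases x; cases y; cases z) simp_all
  show "(x + y) * z = x * z + y * z"
    by (cases x; cases y; cases z) simp_all
  show "x * (y + z) = x * y + x * z"
    by (cases x; cases y; cases z) simp_all
qed

end

datatype S2 = W2 | A2

instantiation S2 :: semiring
begin

fun plus_S2 :: "S2 \<Rightarrow> S2 \<Rightarrow> S2" where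
  "W2 + W2 = (W2 :: S2)" |
  "W2 + A2 = (A2 :: S2)" |
  "A2 + W2 = (A2 :: S2)" |
  "A2 + A2 = (A2 :: S2)"

fun times_S2 :: "S2 \<Rightarrow> S2 \<Rightarrow> S2" where
  "W2 * W2 = (W2 :: S2)" |
  "W2 * A2 = (W2 :: S2)" |
  "A2 * W2 = (W2 :: S2)" |
  "A2 * A2 = (A2 :: S2)"

instance
proof
  fix x y z :: S2
  show "(x + y) + z = x + (y + z)"
    by (cases x; cases y; cases z) simp_all
  show "x + y = y + x"
    by (cases x; cases y) simp_all
  show "(x * y) * z = x * (y * z)"
    by (cases x; cases y; cases z) simp_all
  show "(x + y) * z = x * z + y * z"
    by (cases x; cases y; cases z) simp_all
  show "x * (y + z) = x * y + x * z"
    by (cases x; cases y; cases z) simp_all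
qed

end

datatype S3 = W3 | A3

instantiation S3 :: semiring
begin

fun plus_S3 :: "S3 \<Rightarrow> S3 \<Rightarrow> S3" where
  "W3 + W3 = (W3 :: S3)" |
  "W3 + A3 = (W3 :: S3)" |
  "A3 + W3 = (W3 :: S3)" |
  "A3 + A3 = (A3 :: S3)"

fun times_S3 :: "S3 \<Rightarrow> S3 \<Rightarrow> S3" where
  "W3 * W3 = (W3 :: S3)" |
  "W3 * A3 = (W3 :: S3)" |
  "A3 * W3 = (W3 :: S3)" |
  "A3 * A3 = (A3 :: S3)"

instance
proof
  fix x y z :: S3
  show "(x + y) + z = x + (y + z)"
    by (cases x; cases y; cases z) simp_all
  show "x + y = y + x"
    by (cases x; cases y) simp_all
  show "(x * y) * z = x * (y * z)"
    by (cases x; cases y; cases z) simp_all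
  show "(x + y) * z = x * z + y * z"
    by (cases x; cases y; cases z) simp_all
  show "x * (y + z) = x * y + x * z"
    by (cases x; cases y; cases z) simp_all
qed

end

datatype S4 = W4 | A4

instantiation S4 :: semiring
begin

fun plus_S4 :: "S4 \<Rightarrow> S4 \<Rightarrow> S4" where
  "W4 + W4 = (W4 :: S4)" |
  "W4 + A4 = (W4 :: S4)" |
  "A4 + W4 = (W4 :: S4)" |
  "A4 + A4 = (W4 :: S4)"

fun times_S4 :: "S4 \<Rightarrow> S4 \<Rightarrow> S4" where
  "W4 * W4 = (W4 :: S4)" |
  "W4 * A4 = (W4 :: S4)" |
  "A4 * W4 = (W4 :: S4)" |
  "A4 * A4 = (A4 :: S4)"

instance
proof
  fix x y z :: S4
  show "(x + y) + z = x + (y + z)"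
    by (cases x; cases y; cases z) simp_all
  show "x + y = y + x"
    by (cases x; cases y) simp_all
  show "(x * y) * z = x * (y * z)"
    by (cases x; cases y; cases z) simp_all
  show "(x + y) * z = x * z + y * z"
    by (cases x; cases y; cases z) simp_all
  show "x * (y + z) = x * y + x * z"
    by (cases x; cases y; cases z) simp_all
qed

end

datatype S5 = A5 | W5

instantiation S5 :: semiring
begin

fun plus_S5 :: "S5 \<Rightarrow> S5 \<Rightarrow> S5" where
  "A5 + A5 = (A5 :: S5)" |
  "A5 + W5 = (W5 :: S5)" |
  "W5 + A5 = (W5 :: S5)" |
  "W5 + W5 = (W5 :: S5)"

definition times_S5 :: "S5 \<Rightarrow> S5 \<Rightarrow> S5" where
  "x * y = (x :: S5)"

instance
proof
  fix x y z :: S5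
  show "(x + y) + z = x + (y + z)"
    by (cases x; cases y; cases z) (simp_all add: times_S5_def)
  show "x + y = y + x"
    by (cases x; cases y) (simp_all add: times_S5_def)
  show "(x * y) * z = x * (y * z)"
    by (cases x; cases y; cases z) (simp_all add: times_S5_def)
  show "(x + y) * z = x * z + y * z"
    by (cases x; cases y; cases z) (simp_all add: times_S5_def)
  show "x * (y + z) = x * y + x * z"
    by (cases x; cases y; cases z) (simp_all add: times_S5_def)
qed

end

datatype S6 = A6 | W6

instantiation S6 :: semiring
begin

fun plus_S6 :: "S6 \<Rightarrow> S6 \<Rightarrow> S6" where
  "A6 + A6 = (A6 :: S6)" |
  "A6 + W6 = (W6 :: S6)" |
  "W6 + A6 = (W6 :: S6)" |
  "W6 + W6 = (W6 :: S6)"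

definition times_S6 :: "S6 \<Rightarrow> S6 \<Rightarrow> S6" where
  "x * y = (y :: S6)"

instance
proof
  fix x y z :: S6
  show "(x + y) + z = x + (y + z)"
    by (cases x; cases y; cases z) (simp_all add: times_S6_def)
  show "x + y = y + x"
    by (cases x; cases y) (simp_all add: times_S6_def)
  show "(x * y) * z = x * (y * z)"
    by (cases x; cases y; cases z) (simp_all add: times_S6_def)
  show "(x + y) * z = x * z + y * z"
    by (cases x; cases y; cases z) (simp_all add: times_S6_def)
  show "x * (y + z) = x * y + x * z"
    by (cases x; cases y; cases z) (simp_all add: times_S6_def)
qed

end

datatype S7 = A7 | B7 | W7

instantiation S7 :: linorder
begin

text \<open>The order is A7 < B7 < W7.\<close>

definition less_eq_S7 :: "S7 \<Rightarrow> S7 \<Rightarrow> bool" where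
  "x \<le> y \<longleftrightarrow> x = A7 \<or> y = W7 \<or> x = (y :: S7)"

definition less_S7 :: "S7 \<Rightarrow> S7 \<Rightarrow> bool" where
  "x < y \<longleftrightarrow> x \<le> y \<and> x \<noteq> (y :: S7)"

instance
proof
  fix x y z :: S7
  show "x < y \<longleftrightarrow> x \<le> y \<and> \<not> y \<le> x"
    by (cases x; cases y) (auto simp: less_S7_def less_eq_S7_def)
  show "x \<le> x"
    by (simp add: less_eq_S7_def)
  show "x \<le> y \<Longrightarrow> y \<le> z \<Longrightarrow> x \<le> z"
    by (auto simp: less_eq_S7_def)
  show "x \<le> y \<Longrightarrow> y \<le> x \<Longrightarrow> x = y"
    by (auto simp: less_eq_S7_def)
  show "x \<le> y \<or> y \<le> x"
    by (cases x; cases y) (auto simp: less_eq_S7_def)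
qed

end

instantiation S7 :: semiring
begin

definition plus_S7 :: "S7 \<Rightarrow> S7 \<Rightarrow> S7" where
  "x + y = max x (y :: S7)"

fun times_S7 :: "S7 \<Rightarrow> S7 \<Rightarrow> S7" where
  "A7 * x = (A7 :: S7)" |
  "B7 * x = (x :: S7)" |
  "W7 * x = (W7 :: S7)"

instance
proof
  fix x y z :: S7
  show "(x + y) + z = x + (y + z)"
    by (cases x; cases y; cases z) (simp_all add: plus_S7_def max_def less_eq_S7_def)
  show "x + y = y + x"
    by (cases x; cases y) (simp_all add: plus_S7_def max_def less_eq_S7_def)
  show "(x * y) * z = x * (y * z)"
    by (cases x; cases y; cases z) (simp_all add: plus_S7_def max_def less_eq_S7_def)
  show "(x + y) * z = x * z + y * z"
    by (cases x; cases y; cases z) (simp_all add: plus_S7_def max_def less_eq_S7_def)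
  show "x * (y + z) = x * y + x * z"
    by (cases x; cases y; cases z) (simp_all add: plus_S7_def max_def less_eq_S7_def)
qed

end

datatype S8 = A8 | B8 | W8

instantiation S8 :: linorder
begin

text \<open>The order is A8 < B8 < W8.\<close>

definition less_eq_S8 :: "S8 \<Rightarrow> S8 \<Rightarrow> bool" where
  "x \<le> y \<longleftrightarrow> x = A8 \<or> y = W8 \<or> x = (y :: S8)"

definition less_S8 :: "S8 \<Rightarrow> S8 \<Rightarrow> bool" where
  "x < y \<longleftrightarrow> x \<le> y \<and> x \<noteq> (y :: S8)"

instance
proof
  fix x y z :: S8
  show "x < y \<longleftrightarrow> x \<le> y \<and> \<not> y \<le> x"
    by (cases x; cases y) (auto simp: less_S8_def less_eq_S8_def)
  show "x \<le> x"
    by (simp add: less_eq_S8_def)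
  show "x \<le> y \<Longrightarrow> y \<le> z \<Longrightarrow> x \<le> z"
    by (auto simp: less_eq_S8_def)
  show "x \<le> y \<Longrightarrow> y \<le> x \<Longrightarrow> x = y"
    by (auto simp: less_eq_S8_def)
  show "x \<le> y \<or> y \<le> x"
    by (cases x; cases y) (auto simp: less_eq_S8_def)
qed

end

instantiation S8 :: semiring
begin

definition plus_S8 :: "S8 \<Rightarrow> S8 \<Rightarrow> S8" where
  "x + y = max x (y :: S8)"

fun times_S8 :: "S8 \<Rightarrow> S8 \<Rightarrow> S8" where
  "x * A8 = (A8 :: S8)" |
  "x * B8 = (x :: S8)" |
  "x * W8 = (W8 :: S8)"

instance
proof
  fix x y z :: S8
  show "(x + y) + z = x + (y + z)"
    by (cases x; cases y; cases z) (simp_all add: plus_S8_def max_def less_eq_S8_def)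
  show "x + y = y + x"
    by (cases x; cases y) (simp_all add: plus_S8_def max_def less_eq_S8_def)
  show "(x * y) * z = x * (y * z)"
    by (cases x; cases y; cases z) (simp_all add: plus_S8_def max_def less_eq_S8_def)
  show "(x + y) * z = x * z + y * z"
    by (cases x; cases y; cases z) (simp_all add: plus_S8_def max_def less_eq_S8_def)
  show "x * (y + z) = x * y + x * z"
    by (cases x; cases y; cases z) (simp_all add: plus_S8_def max_def less_eq_S8_def)
qed

end

end

theory Submission
  imports Defs
begin

text \<open>
  Multiplicative idempotence makes \<open>x \<mapsto> x + x\<close> an endomorphism, so simplicity leaves two cases:
  either addition is idempotent, or all doubles coincide in an element \<open>w\<close>. In the second case,
  \<open>x \<mapsto> x + w\<close> is again an endomorphism, which leads either to a Boolean ring, hence to \<open>S1\<close>, or to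
  constant addition, hence to \<open>S4\<close>.

  If addition is idempotent, let \<open>K\<close> be the least multiplicative ideal, a rectangular band.
  Simplicity makes the left action of \<open>S\<close> on \<open>K\<close> either faithful or trivial, and likewise the right
  action. If both are trivial, then \<open>K\<close> consists of a multiplicative zero, which is additively
  either neutral (\<open>S2\<close>) or absorbing (\<open>S3\<close>). If the left action is faithful, then \<open>K\<close> consists of
  left zeros, and for each \<open>m \<in> K\<close> the relation \<open>\<forall>k\<in>K. x k + m = y k + m\<close> is a congruence. Hence
  each element of \<open>K\<close> is least or greatest in \<open>K\<close>, so \<open>K\<close> has two elements and \<open>S\<close> consists of
  monotone self-maps of \<open>K\<close> (\<open>S5\<close> or \<open>S7\<close>). The other side is dual (\<open>S6\<close> or \<open>S8\<close>).
\<close>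

section \<open>Congruences of a simple idempotent semiring\<close>

text \<open>Only the multiplication is a parameter, so that the locale can be interpreted by its dual.\<close>

locale simple_idempotent_semiring =
  fixes mul :: "'a::ab_semigroup_add \<Rightarrow> 'a \<Rightarrow> 'a" (infixl "\<cdot>" 70)
  assumes mul_assoc: "(x \<cdot> y) \<cdot> z = x \<cdot> (y \<cdot> z)"
    and distrib_right: "(x + y) \<cdot> z = x \<cdot> z + y \<cdot> z"
    and distrib_left: "x \<cdot> (y + z) = x \<cdot> y + x \<cdot> z"
    and mul_idem: "x \<cdot> x = x"
    and nontrivial: "\<exists>x y :: 'a. x \<noteq> y"
    and simple: "\<lbrakk>equivp R; \<And>x y z. R x y \<Longrightarrow> R (x + z) (y + z);
        \<And>x y z. R x y \<Longrightarrow> R (z \<cdot> x) (z \<cdot> y); \<And>x y z. R x y \<Longrightarrow> R (x \<cdot> z) (y \<cdot> z)\<rbrakk>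
      \<Longrightarrow> (\<forall>x y. R x y \<longrightarrow> x = y) \<or> (\<forall>x y. R x y)"
begin

lemma dual: "simple_idempotent_semiring (\<lambda>x y. y \<cdot> x)"
  by unfold_locales
    (rule mul_assoc[symmetric] distrib_left distrib_right mul_idem nontrivial
      | rule simple; blast)+

lemma mul_left_idem: "x \<cdot> (x \<cdot> y) = x \<cdot> y"
  by (metis mul_assoc mul_idem)

text \<open>The codomain is arbitrary because \<open>f\<close> often records the annihilator of an
  element or its action on an ideal, as a predicate or a function.\<close>

lemma simple_kernel:
  fixes f :: "'a \<Rightarrow> 'b"
  assumes "\<And>x y z. f x = f y \<Longrightarrow> f (x + z) = f (y + z)"
    and "\<And>x y z. f x = f y \<Longrightarrow> f (z \<cdot> x) = f (z \<cdot> y)"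
    and "\<And>x y z. f x = f y \<Longrightarrow> f (x \<cdot> z) = f (y \<cdot> z)"
  shows "inj f \<or> (\<forall>x y. f x = f y)"
proof -
  have "equivp (\<lambda>x y. f x = f y)"
    by (auto intro!: equivpI reflpI sympI transpI)
  then have "(\<forall>x y. f x = f y \<longrightarrow> x = y) \<or> (\<forall>x y. f x = f y)"
    by (rule simple) (fact assms)+
  then show ?thesis
    by (simp add: inj_def)
qed

text \<open>The kernel of an endomorphism is a congruence. If \<open>f\<close> is injective,
  \<open>f (f x) = f x\<close> cancels to \<open>f x = x\<close>.\<close>

lemma simple_endo:
  assumes add: "\<And>x y. f (x + y) = f x + f y" and mul: "\<And>x y. f (x \<cdot> y) = f x \<cdot> f y"
    and idem: "\<And>x. f (f x) = f x"
  shows "(\<forall>x. f x = x) \<or> (\<forall>x y. f x = f y)"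
  using simple_kernel[of f] idem by (auto simp: add mul inj_def)

section \<open>Multiplicative zeros\<close>

lemma zero_if_mul_swap:
  assumes zero: "\<And>x. z \<cdot> x = z" "\<And>x. x \<cdot> z = z" and "x \<cdot> y = z"
  shows "y \<cdot> x = z"
  by (metis assms mul_assoc mul_idem)

lemma zero_if_mul_insert:
  assumes zero: "\<And>x. z \<cdot> x = z" "\<And>x. x \<cdot> z = z" and "x \<cdot> y = z"
  shows "x \<cdot> (s \<cdot> y) = z"
proof -
  have "y \<cdot> x = z"
    using zero_if_mul_swap[of z x y] assms by blast
  \<comment> \<open>Reassociated, the product is \<open>(x s y) (x s y)\<close>, which is
    \<open>x s y\<close>.\<close>
  then have "(x \<cdot> s) \<cdot> (y \<cdot> x) \<cdot> (s \<cdot> y) = z"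
    using zero by simp
  then show ?thesis
    by (metis mul_assoc mul_idem)
qed

text \<open>The hypotheses make the partition into \<open>{z}\<close> and its complement a
  congruence. It is not the full relation, so it is equality.\<close>

lemma two_elements_if_nonzero_closed:
  assumes zero: "\<And>x. z \<cdot> x = z" "\<And>x. x \<cdot> z = z"
    and add: "\<And>x y u. x \<noteq> z \<Longrightarrow> y \<noteq> z \<Longrightarrow> x + u = z \<longleftrightarrow> y + u = z"
    and mul: "\<And>x y. x \<cdot> y = z \<Longrightarrow> x = z \<or> y = z"
  shows "\<exists>a. a \<noteq> z \<and> UNIV = {z, a}"
proof -
  have "inj (\<lambda>x. x = z) \<or> (\<forall>x y. (x = z) = (y = z))"
    using add mul by (intro simple_kernel) (use zero in metis)+
  moreover have "\<not> (\<forall>x y. (x = z) = (y = z))"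
    using nontrivial by metis
  ultimately have "x = y" if "x \<noteq> z" "y \<noteq> z" for x y
    using that by (auto simp: inj_def)
  moreover obtain a where "a \<noteq> z"
    using nontrivial by metis
  ultimately show ?thesis
    by blast
qed

text \<open>Multiplication by \<open>a\<close> has a congruence as kernel. For \<open>a\<close>
  other than \<open>z\<close> it is not constant, hence injective, and \<open>a (a x) = a x\<close>
  makes \<open>a\<close> an identity. Identities are unique.\<close>

lemma two_elements_if_commutative:
  assumes zero: "\<And>x. z \<cdot> x = z"
    and comm: "\<And>x y. x \<cdot> y = y \<cdot> x"
  shows "\<exists>a. a \<noteq> z \<and> UNIV = {z, a}"
proof -
  have unit: "a \<cdot> x = x" if "a \<noteq> z" for a x
  proof -
    have "inj (\<lambda>x. a \<cdot> x) \<or> (\<forall>x y. a \<cdot> x = a \<cdot> y)"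
      by (rule simple_kernel) (simp_all add: distrib_left, (metis mul_assoc comm)+)
    moreover have "a \<cdot> a \<noteq> a \<cdot> z"
      using that zero by (metis comm mul_idem)
    ultimately have "inj (\<lambda>x. a \<cdot> x)"
      by blast
    then show ?thesis
      by (simp add: inj_def mul_left_idem)
  qed
  then have "x = y" if "x \<noteq> z" "y \<noteq> z" for x y
    using that comm by metis
  moreover obtain a where "a \<noteq> z"
    using nontrivial by metis
  ultimately show ?thesis
    by blast
qed

lemma no_zero_divisors_if_absorbing:
  assumes zero: "\<And>x. z \<cdot> x = z" "\<And>x. x \<cdot> z = z" and absorb: "\<And>x. z + x = z"
    and "x \<cdot> y = z"
  shows "x = z \<or> y = z"
proof -
  \<comment> \<open>Collapse the ideal of left annihilators of \<open>y\<close>.\<close>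
  let ?f = "\<lambda>x. if x \<cdot> y = z then z else x"
  have ann: "(s \<cdot> u) \<cdot> y = z" "(u \<cdot> s) \<cdot> y = z" "(u + s) \<cdot> y = z" if "u \<cdot> y = z" for u s
    using that zero zero_if_mul_insert[of z u y s] by (simp_all add: mul_assoc distrib_right absorb)
  have "?f u = ?f v \<longleftrightarrow> u \<cdot> y = z \<and> v \<cdot> y = z \<or> u = v" for u v
    using zero by auto
  then have "inj ?f \<or> (\<forall>u v. ?f u = ?f v)"
    by (intro simple_kernel) (metis ann)+
  then show ?thesis
  proof
    assume "inj ?f"
    moreover have "?f x = ?f z"
      using assms(4) zero by simp
    ultimately have "x = z"
      by (rule injD)
    then show ?thesis
      by blast
  next
    assume "\<forall>u v. ?f u = ?f v"
    then have "?f y = ?f z" by blast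
    then show ?thesis
      by (simp add: mul_idem zero split: if_splits)
  qed
qed

section \<open>Doubles\<close>

text \<open>Expanding \<open>(x + x) (x + x)\<close> gives four copies of \<open>x\<close>, so four
  copies add up to the same as two. Hence doubling is multiplicative and idempotent.\<close>

lemma add_idem_or_constant_double: "(\<forall>x :: 'a. x + x = x) \<or> (\<exists>w :: 'a. \<forall>x. x + x = w)"
proof -
  have quad: "(x + x) + (x + x) = x + x" for x :: 'a
    using mul_idem[of "x + x"] by (simp only: distrib_left distrib_right) (simp only: mul_idem)
  have "(\<forall>x :: 'a. x + x = x) \<or> (\<forall>x y :: 'a. x + x = y + y)"
    by (rule simple_endo) (simp_all add: quad[unfolded add.assoc] distrib_left distrib_right ac_simps)
  then show ?thesis
    by metis
qed

lemma constant_double_cases: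
  assumes double: "\<And>x. x + x = w"
  shows "(\<forall>x. w \<cdot> x = w) \<and> (\<forall>x. x \<cdot> w = w) \<and> (\<exists>a. a \<noteq> w \<and> UNIV = {w, a}) \<and>
    ((\<forall>x. w + x = x) \<or> (\<forall>x y. x + y = w))"
proof -
  \<comment> \<open>A double multiplied by any element is the double of a product, hence
    \<open>w\<close> again.\<close>
  have zero: "w \<cdot> x = w" "x \<cdot> w = w" for x
    using double distrib_left distrib_right by metis+
  have "(\<forall>x. x + w = x) \<or> (\<forall>x y. x + w = y + w)"
  proof (rule simple_endo)
    show "x + y + w = x + w + (y + w)" for x y
      using double[of w] by (metis add.assoc add.commute)
    show "x \<cdot> y + w = (x + w) \<cdot> (y + w)" for x y
      by (simp add: distrib_left distrib_right zero double add.assoc)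
    show "x + w + w = x + w" for x
      using double by (simp add: add.assoc)
  qed
  then show ?thesis
  proof
    assume neutral: "\<forall>x. x + w = x"
    \<comment> \<open>As in a Boolean ring, each element is its own additive inverse, and expanding
      \<open>(x + y) (x + y)\<close> leaves \<open>x y + y x = w\<close>.\<close>
    have "x \<cdot> y = y \<cdot> x" for x y
    proof -
      have "x + y = (x + y) \<cdot> (x + y)"
        by (simp add: mul_idem)
      also have "\<dots> = (x + y) + (x \<cdot> y + y \<cdot> x)"
        by (simp only: distrib_left distrib_right) (simp add: mul_idem ac_simps)
      finally have "x \<cdot> y + y \<cdot> x = w"
        by (metis add.assoc add.commute double neutral)
      then show ?thesis
        by (metis add.assoc add.commute double neutral)
    qed
    then have "\<exists>a. a \<noteq> w \<and> UNIV = {w, a}"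
      using two_elements_if_commutative zero by blast
    then show ?thesis
      using neutral zero by (simp add: add.commute)
  next
    assume "\<forall>x y. x + w = y + w"
    then have absorb: "w + x = w" for x
      by (metis add.commute double)
    have const: "x + y = w" for x y
    proof -
      \<comment> \<open>Expanding \<open>(x + y)^3\<close>, the two terms \<open>x x y\<close> and \<open>x y y\<close> add up to \<open>w\<close>.\<close>
      have "x + y = (x + y) \<cdot> ((x + y) \<cdot> (x + y))"
        by (simp add: mul_idem)
      also have "\<dots> = (x \<cdot> y + x \<cdot> y) +
          (x + x \<cdot> (y \<cdot> x) + y \<cdot> x + y \<cdot> (x \<cdot> y) + y \<cdot> x + y)"
        by (simp only: distrib_left distrib_right) (simp add: mul_left_idem mul_idem ac_simps)
      finally show ?thesis
        by (simp add: double absorb)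
    qed
    have "\<exists>a. a \<noteq> w \<and> UNIV = {w, a}"
      using no_zero_divisors_if_absorbing[OF zero absorb]
      by (intro two_elements_if_nonzero_closed zero) (simp_all add: const)
    then show ?thesis
      using zero const by blast
  qed
qed

section \<open>Minimal idempotents and idempotent addition with a zero\<close>

text \<open>
  For idempotents, \<open>k x k\<close> lies below \<open>k\<close> in the natural order \<open>e \<le> f \<longleftrightarrow> e f = e = f e\<close>, so any
  minimal element will do.
\<close>

lemma minimal_idempotent:
  assumes "finite A" "A \<noteq> {}" and closed: "\<And>x y. x \<in> A \<Longrightarrow> y \<in> A \<Longrightarrow> x \<cdot> y \<in> A"
  shows "\<exists>k\<in>A. \<forall>x\<in>A. k \<cdot> x \<cdot> k = k"
proof -
  \<comment> \<open>Minimality is reached by counting: \<open>D e\<close> holds the elements of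
    \<open>A\<close> below \<open>e\<close>.\<close>
  define D where "D e = {y \<in> A. e \<cdot> y = y \<and> y \<cdot> e = y}" for e
  define k where "k = arg_min_on (\<lambda>e. card (D e)) A"
  have k: "k \<in> A" "\<And>e. e \<in> A \<Longrightarrow> card (D k) \<le> card (D e)"
    using assms arg_min_if_finite[of A "\<lambda>e. card (D e)"] unfolding k_def by (auto simp: not_less)
  have "k \<cdot> x \<cdot> k = k" if "x \<in> A" for x
  proof (rule ccontr)
    assume neq: "k \<cdot> x \<cdot> k \<noteq> k"
    have "D (k \<cdot> x \<cdot> k) \<subseteq> D k"
      unfolding D_def by (smt (verit) Collect_mono mul_assoc mul_idem)
    moreover have "k \<in> D k" "k \<notin> D (k \<cdot> x \<cdot> k)"
      using k neq by (auto simp: D_def mul_idem mul_assoc)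
    ultimately have "card (D (k \<cdot> x \<cdot> k)) < card (D k)"
      using \<open>finite A\<close> by (intro psubset_card_mono) (auto simp: D_def)
    then show False
      using k closed that by (metis not_less)
  qed
  then show ?thesis
    using k by blast
qed

lemma zero_cases:
  assumes "finite (UNIV :: 'a set)" and add_idem: "\<And>x :: 'a. x + x = x"
    and zero: "\<And>x. z \<cdot> x = z" "\<And>x. x \<cdot> z = z"
  shows "(\<exists>a. a \<noteq> z \<and> UNIV = {z, a}) \<and> ((\<forall>x. z + x = x) \<or> (\<forall>x. z + x = z))"
proof -
  have "(\<forall>x. x + z = x) \<or> (\<forall>x y. x + z = y + z)"
  proof (rule simple_endo)
    show "x + y + z = x + z + (y + z)" for x y
      using add_idem[of z] by (metis add.assoc add.commute)
    show "x \<cdot> y + z = (x + z) \<cdot> (y + z)" for x y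
      by (simp add: distrib_left distrib_right zero add_idem add.assoc)
    show "x + z + z = x + z" for x
      using add_idem by (simp add: add.assoc)
  qed
  then show ?thesis
  proof
    assume neutral: "\<forall>x. x + z = x"
    have sum: "x + y = z \<longleftrightarrow> x = z \<and> y = z" for x y
      using neutral add_idem by (metis add.assoc add.commute)
    have swap: "x \<cdot> y = z \<longleftrightarrow> y \<cdot> x = z" for x y
      using zero_if_mul_swap[of z] zero by blast
    have insert: "x \<cdot> (s \<cdot> y) = z" if "x \<cdot> y = z" for x y s
      using zero_if_mul_insert[of z] zero that by blast
    \<comment> \<open>Having the same right annihilator is a congruence: \<open>sum\<close> handles
      addition, and \<open>swap\<close> moves a left factor to the right.\<close>
    have "inj (\<lambda>x b. x \<cdot> b = z) \<or> (\<forall>x y. (\<lambda>b. x \<cdot> b = z) = (\<lambda>b. y \<cdot> b = z))"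
    proof (rule simple_kernel)
      fix x y u
      assume eq: "(\<lambda>b. x \<cdot> b = z) = (\<lambda>b. y \<cdot> b = z)"
      show "(\<lambda>b. (x + u) \<cdot> b = z) = (\<lambda>b. (y + u) \<cdot> b = z)"
        using eq by (simp add: distrib_right sum fun_eq_iff)
      show "(\<lambda>b. (u \<cdot> x) \<cdot> b = z) = (\<lambda>b. (u \<cdot> y) \<cdot> b = z)"
        using eq by (simp add: swap[of u] mul_assoc fun_eq_iff)
      show "(\<lambda>b. (x \<cdot> u) \<cdot> b = z) = (\<lambda>b. (y \<cdot> u) \<cdot> b = z)"
        using eq by (simp add: mul_assoc fun_eq_iff)
    qed
    moreover have "\<not> (\<forall>x y. (\<lambda>b. x \<cdot> b = z) = (\<lambda>b. y \<cdot> b = z))"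
      using nontrivial zero mul_idem by metis
    ultimately have faithful: "inj (\<lambda>x b. x \<cdot> b = z)"
      by blast
    \<comment> \<open>Insert \<open>x\<close> before \<open>b\<close> and multiply by
      \<open>y\<close>: \<open>y x y x b\<close> is \<open>y x b\<close>. So \<open>x y\<close> and
      \<open>y x\<close> have the same annihilator, which forces commutativity.\<close>
    have ann: "(y \<cdot> x) \<cdot> b = z" if "(x \<cdot> y) \<cdot> b = z" for x y b
    proof -
      have "(x \<cdot> y) \<cdot> (x \<cdot> b) = z"
        using insert that by blast
      then have "y \<cdot> ((x \<cdot> y) \<cdot> (x \<cdot> b)) = z"
        using zero by simp
      then show ?thesis
        by (metis mul_assoc mul_idem)
    qed
    have "x \<cdot> y = y \<cdot> x" for x y
      using ann by (intro injD[OF faithful]) blast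
    then have "\<exists>a. a \<noteq> z \<and> UNIV = {z, a}"
      using two_elements_if_commutative zero by blast
    then show ?thesis
      using neutral by (simp add: add.commute)
  next
    assume "\<forall>x y. x + z = y + z"
    then have absorb: "z + x = z" for x
      by (metis add.commute add_idem)
    note nzd = no_zero_divisors_if_absorbing[OF zero absorb]
    have "- {z} \<noteq> {}"
      using nontrivial by (metis ComplI empty_iff singletonD)
    \<comment> \<open>By \<open>nzd\<close> the complement of \<open>z\<close> is closed under
      multiplication. A minimal idempotent \<open>k\<close> in it detects sums, as
      \<open>k (x + y) k = k + k = k\<close>.\<close>
    then have "\<exists>k\<in>- {z}. \<forall>x\<in>- {z}. k \<cdot> x \<cdot> k = k"
      using assms(1) nzd by (intro minimal_idempotent) (auto intro: finite_subset)
    then obtain k where k: "k \<noteq> z" "\<And>x. x \<noteq> z \<Longrightarrow> k \<cdot> x \<cdot> k = k"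
      by auto
    have "x + y \<noteq> z" if "x \<noteq> z" "y \<noteq> z" for x y
    proof
      assume "x + y = z"
      then have "k \<cdot> (x + y) \<cdot> k = z"
        by (simp add: zero)
      then show False
        using k that by (simp add: distrib_left distrib_right add_idem)
    qed
    then have "\<exists>a. a \<noteq> z \<and> UNIV = {z, a}"
      using nzd by (intro two_elements_if_nonzero_closed zero) (metis absorb add.commute, blast)
    then show ?thesis
      using absorb by blast
  qed
qed

section \<open>Left zeros with a faithful action\<close>

lemma faithful_left_zeros_cases:
  assumes add_idem: "\<And>x :: 'a. x + x = x" and "K \<noteq> {}"
    and "\<forall>k\<in>K. \<forall>x. x \<cdot> k \<in> K" and "\<forall>k\<in>K. \<forall>x. k \<cdot> x = k"
    and "\<forall>x y. (\<forall>k\<in>K. x \<cdot> k = y \<cdot> k) \<longrightarrow> x = y"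
  shows "\<exists>a w. a \<noteq> w \<and> a + w = w \<and> (\<forall>x. a \<cdot> x = a) \<and> (\<forall>x. w \<cdot> x = w) \<and>
    (UNIV = {a, w} \<or>
     (\<exists>b. b \<noteq> a \<and> b \<noteq> w \<and> UNIV = {a, b, w} \<and> a + b = b \<and> b + w = w \<and> b \<cdot> a = a \<and> b \<cdot> w = w))"
proof -
  have add_left_idem: "x + (x + y) = x + y" for x y :: 'a
    by (metis add.assoc add_idem)
  have ideal: "x \<cdot> k \<in> K" and left_zero: "k \<cdot> x = k" if "k \<in> K" for x k
    using assms(3,4) that by blast+
  have faithful: "x = y" if "\<And>k. k \<in> K \<Longrightarrow> x \<cdot> k = y \<cdot> k" for x y
    using assms(5) that by blast
  have extremal: "(\<forall>k\<in>K. k + m = m) \<or> (\<forall>k\<in>K. k + m = k)" if m: "m \<in> K" for m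
  proof -
    \<comment> \<open>The default \<open>m\<close> outside \<open>K\<close> is independent of
      \<open>x\<close>, so the kernel compares only actions on \<open>K\<close>, joined with
      \<open>m\<close>.\<close>
    let ?f = "\<lambda>x k. if k \<in> K then x \<cdot> k + m else m"
    have eq_iff: "?f x = ?f y \<longleftrightarrow> (\<forall>k\<in>K. x \<cdot> k + m = y \<cdot> k + m)" for x y
      by (auto simp: fun_eq_iff)
    \<comment> \<open>In the join order, \<open>s m\<close> lies below \<open>s u + m\<close>. This
      lets \<open>u m\<close> be dropped when the kernel is checked for left multiplication by
      \<open>u\<close>.\<close>
    have below: "s \<cdot> m + (s \<cdot> u + m) = s \<cdot> u + m" for s u
    proof -
      have "s + m = (s + m) \<cdot> (s + m)"
        by (simp add: mul_idem)
      also have "\<dots> = s \<cdot> m + (s + m)"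
        by (simp only: distrib_left distrib_right)
          (simp add: left_zero m mul_idem add_left_idem ac_simps)
      finally have "(s + m) \<cdot> u = (s \<cdot> m + (s + m)) \<cdot> u"
        by simp
      then show ?thesis
        using left_zero[OF m] by (simp add: distrib_right mul_assoc)
    qed
    have "inj ?f \<or> (\<forall>x y. ?f x = ?f y)"
    proof (rule simple_kernel; unfold eq_iff; intro ballI)
      fix x y u k
      assume eq: "\<forall>k\<in>K. x \<cdot> k + m = y \<cdot> k + m" and k: "k \<in> K"
      show "(x + u) \<cdot> k + m = (y + u) \<cdot> k + m"
        using eq k unfolding distrib_right by (metis add.assoc add.commute)
      show "(x \<cdot> u) \<cdot> k + m = (y \<cdot> u) \<cdot> k + m"
        using eq k ideal by (simp add: mul_assoc)
      have "u \<cdot> (x \<cdot> k + m) = u \<cdot> (y \<cdot> k + m)"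
        using eq k by simp
      then have "(u \<cdot> m + u \<cdot> (x \<cdot> k)) + m = (u \<cdot> m + u \<cdot> (y \<cdot> k)) + m"
        by (simp add: distrib_left add.commute)
      then show "(u \<cdot> x) \<cdot> k + m = (u \<cdot> y) \<cdot> k + m"
        by (simp add: below mul_assoc add.assoc)
    qed
    then show ?thesis
    proof
      assume "inj ?f"
      \<comment> \<open>Both \<open>k + m\<close> and \<open>k\<close> act on \<open>K\<close> as
        constants, and joining with \<open>m\<close> turns both into \<open>k + m\<close>.\<close>
      have "k + m = k" if "k \<in> K" for k
      proof -
        have "?f (k + m) = ?f k"
          using that m left_zero unfolding eq_iff by (simp add: distrib_right add_idem add.assoc)
        with \<open>inj ?f\<close> show ?thesis
          by (rule injD)
      qed
      then show ?thesis
        by blast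
    next
      assume "\<forall>x y. ?f x = ?f y"
      \<comment> \<open>Compare the actions of \<open>k\<close> and \<open>m\<close> at the argument
        \<open>m\<close>; for \<open>k\<close> in \<open>K\<close> this makes \<open>m\<close>
        greatest.\<close>
      then have "k \<cdot> m + m = m \<cdot> m + m" for k
        using m unfolding eq_iff by blast
      then show ?thesis
        by (metis add_idem left_zero m)
    qed
  qed
  obtain k where k: "k \<in> K"
    using \<open>K \<noteq> {}\<close> by blast
  have "K \<noteq> {k}"
  proof
    assume "K = {k}"
    have "x = y" for x y :: 'a
      by (rule faithful) (use ideal[OF k] \<open>K = {k}\<close> in auto)
    then show False
      using nontrivial by blast
  qed
  then obtain l where l: "l \<in> K" "l \<noteq> k"
    using k by blast
  have "k + l = l \<or> l + k = k"
    using extremal[OF l(1)] k by (auto simp: add.commute)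
  then obtain a w where aw: "a \<in> K" "w \<in> K" "a \<noteq> w" "a + w = w"
    using k l by blast
  have wa: "w + a = w"
    using aw(4) by (simp add: add.commute)
  have top: "j + w = w" and bot: "j + a = j" if "j \<in> K" for j
    using extremal[OF aw(2)] extremal[OF aw(1)] aw wa that by auto
  have K: "j = a \<or> j = w" if j: "j \<in> K" for j
  proof -
    have "w + j = j \<or> a + j = a"
      using extremal[OF j] aw by blast
    then show ?thesis
      using top[OF j] bot[OF j] by (auto simp: add.commute)
  qed
  note za = left_zero[OF aw(1)] and zw = left_zero[OF aw(2)]
  have eqI: "x = y" if "x \<cdot> a = y \<cdot> a" "x \<cdot> w = y \<cdot> w" for x y
    by (rule faithful) (use that K in blast)
  \<comment> \<open>Each \<open>x\<close> acts monotonically on the chain \<open>a < w\<close>,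
    hence as one of the two constants or as the identity.\<close>
  have act: "x = a \<or> x = w \<or> (x \<cdot> a = a \<and> x \<cdot> w = w)" for x
  proof -
    have "x \<cdot> a + x \<cdot> w = x \<cdot> w"
      using aw(4) by (metis distrib_left)
    moreover have "x \<cdot> a = a \<or> x \<cdot> a = w" "x \<cdot> w = a \<or> x \<cdot> w = w"
      using K ideal aw by blast+
    ultimately show ?thesis
      using eqI[of x a] eqI[of x w] aw za zw wa by auto
  qed
  show ?thesis
  proof (cases "UNIV = {a, w}")
    case True
    then show ?thesis
      using aw za zw by blast
  next
    case False
    then obtain b where b: "b \<noteq> a" "b \<noteq> w"
      by blast
    have bact: "b \<cdot> a = a" "b \<cdot> w = w"
      using act[of b] b by blast+
    have "x \<in> {a, b, w}" for x
      using act[of x] eqI[of x b] bact by auto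
    then have "UNIV = {a, b, w}"
      by blast
    moreover have "a + b = b" "b + w = w"
      by (rule eqI; simp add: distrib_right bact za zw aw add_idem)+
    ultimately show ?thesis
      using aw za zw b bact by blast
  qed
qed

section \<open>The least multiplicative ideal\<close>

lemma minimal_ideal_cases:
  assumes "finite (UNIV :: 'a set)"
  obtains (zero) z where "\<And>x. z \<cdot> x = z" "\<And>x. x \<cdot> z = z"
  | (left) K where "K \<noteq> {}" "\<forall>k\<in>K. \<forall>x. x \<cdot> k \<in> K" "\<forall>k\<in>K. \<forall>x. k \<cdot> x = k"
      "\<forall>x y. (\<forall>k\<in>K. x \<cdot> k = y \<cdot> k) \<longrightarrow> x = y"
  | (right) K where "K \<noteq> {}" "\<forall>k\<in>K. \<forall>x. k \<cdot> x \<in> K" "\<forall>k\<in>K. \<forall>x. x \<cdot> k = k"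
      "\<forall>x y. (\<forall>k\<in>K. k \<cdot> x = k \<cdot> y) \<longrightarrow> x = y"
proof -
  \<comment> \<open>Every ideal contains \<open>k = k x k\<close> for each of its elements
    \<open>x\<close>, so \<open>K\<close>, once shown to be an ideal, is the least one.\<close>
  define K where "K = {k. \<forall>x. k \<cdot> x \<cdot> k = k}"
  have ne: "K \<noteq> {}"
    using minimal_idempotent[of UNIV] assms by (auto simp: K_def)
  have K: "k \<cdot> (x \<cdot> k) = k" if "k \<in> K" for k x
    using that by (simp add: K_def mul_assoc)
  have ideal: "x \<cdot> k \<in> K" "k \<cdot> x \<in> K" if "k \<in> K" for k x
    using K[OF that] unfolding K_def by (auto simp: mul_assoc) (metis mul_assoc)+
  \<comment> \<open>\<open>k x l = (k l k) x l = k (l (k x) l) = k l\<close>.\<close>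
  have rect: "k \<cdot> (x \<cdot> l) = k \<cdot> l" if "k \<in> K" "l \<in> K" for k l x
    using K that by (metis mul_assoc)
  let ?L = "\<lambda>x k. if k \<in> K then x \<cdot> k else k"
  let ?R = "\<lambda>x k. if k \<in> K then k \<cdot> x else k"
  have L: "?L x = ?L y \<longleftrightarrow> (\<forall>k\<in>K. x \<cdot> k = y \<cdot> k)" for x y
    by (auto simp: fun_eq_iff)
  have R: "?R x = ?R y \<longleftrightarrow> (\<forall>k\<in>K. k \<cdot> x = k \<cdot> y)" for x y
    by (auto simp: fun_eq_iff)
  have "inj ?L \<or> (\<forall>x y. ?L x = ?L y)"
    by (rule simple_kernel; unfold L) (simp_all add: distrib_right mul_assoc ideal)
  moreover have "inj ?R \<or> (\<forall>x y. ?R x = ?R y)"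
    by (rule simple_kernel; unfold R)
      (simp_all add: distrib_left ideal flip: mul_assoc)
  ultimately consider "inj ?L" | "inj ?R" | "\<forall>x y. ?L x = ?L y" "\<forall>x y. ?R x = ?R y"
    by blast
  then show thesis
  proof cases
    case 1
    have faithful: "x = y" if "\<And>k. k \<in> K \<Longrightarrow> x \<cdot> k = y \<cdot> k" for x y
      using that by (intro injD[OF 1]) (simp add: L)
    \<comment> \<open>By \<open>rect\<close>, \<open>k x\<close> and \<open>k\<close> act alike on
      \<open>K\<close>.\<close>
    have "k \<cdot> x = k" if "k \<in> K" for k x
      by (rule faithful) (simp add: that rect mul_assoc)
    then show thesis
      using left[of K] ne ideal(1) faithful by blast
  next
    case 2
    have faithful: "x = y" if "\<And>k. k \<in> K \<Longrightarrow> k \<cdot> x = k \<cdot> y" for x y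
      using that by (intro injD[OF 2]) (simp add: R)
    have "x \<cdot> k = k" if "k \<in> K" for k x
      by (rule faithful) (simp add: that rect)
    then show thesis
      using right[of K] ne ideal(2) faithful by blast
  next
    case 3
    obtain z where z: "z \<in> K"
      using ne by blast
    \<comment> \<open>As both actions are trivial, \<open>x\<close> acts on \<open>z\<close> just as
      \<open>z\<close> does.\<close>
    have "x \<cdot> z = z" "z \<cdot> x = z" for x
      using 3 z unfolding L R by (metis mul_idem)+
    then show thesis
      by (rule zero[rotated])
  qed
qed

end

section \<open>Comparison with the eight models\<close>

lemma simple_idempotent_semiring_times:
  assumes "\<forall>x :: 'a :: semiring. x * x = x" and simple: "congruence_simple TYPE('a)"
  shows "simple_idempotent_semiring ((*) :: 'a \<Rightarrow> 'a \<Rightarrow> 'a)"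
proof unfold_locales
  show "\<exists>x y :: 'a. x \<noteq> y"
    using simple by (simp add: congruence_simple_iff)
  fix R :: "'a \<Rightarrow> 'a \<Rightarrow> bool"
  assume equiv: "equivp R" and add: "\<And>x y z. R x y \<Longrightarrow> R (x + z) (y + z)"
    and mul: "\<And>x y z. R x y \<Longrightarrow> R (z * x) (z * y)" "\<And>x y z. R x y \<Longrightarrow> R (x * z) (y * z)"
  have "semiring_congruence {(x, y). R x y}"
    unfolding semiring_congruence_def
  proof (intro conjI allI impI; (unfold mem_Collect_eq case_prod_conv)?)
    show "equiv UNIV {(x, y). R x y}"
      using equiv by (simp add: equivp_equiv)
    fix x x' y y'
    assume "R x x'" "R y y'"
    show "R (x + y) (x' + y')"
      using add[OF \<open>R x x'\<close>, of y] add[OF \<open>R y y'\<close>, of x'] equivp_transp[OF equiv]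
      by (metis add.commute)
    show "R (x * y) (x' * y')"
      using mul \<open>R x x'\<close> \<open>R y y'\<close> equivp_transp[OF equiv] by blast
  qed
  then have "{(x, y). R x y} = Id \<or> {(x, y). R x y} = UNIV"
    using simple by (simp add: congruence_simple_iff)
  then show "(\<forall>x y. R x y \<longrightarrow> x = y) \<or> (\<forall>x y. R x y)"
    by auto
qed (use assms(1) in \<open>simp_all add: mult.assoc ring_distribs\<close>)

text \<open>The map goes out of the model, because there a datatype \<open>case\<close> combinator
  defines it directly.\<close>

lemma semiring_isomorphicI:
  fixes g :: "'b::semiring \<Rightarrow> 'a::semiring"
  assumes "bij g" "\<And>x y. g (x + y) = g x + g y" "\<And>x y. g (x * y) = g x * g y"
  shows "semiring_isomorphic TYPE('a) TYPE('b)"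
proof -
  have "inj g" "\<And>x. g (inv g x) = x"
    using assms(1) by (simp_all add: bij_def surj_f_inv_f)
  then have "inv g (x + y) = inv g x + inv g y" "inv g (x * y) = inv g x * inv g y" for x y
    by (simp_all add: inv_f_eq assms(2,3))
  then have "semiring_iso (inv g)"
    unfolding semiring_iso_def using assms(1) by (simp add: bij_imp_bij_inv)
  then show ?thesis
    unfolding semiring_isomorphic_def by blast
qed

lemma bij_case_two:
  assumes "UNIV = {p, q}" "p \<noteq> q"
  shows "bij (case_S1 p q)" "bij (case_S2 p q)" "bij (case_S3 p q)" "bij (case_S4 p q)"
    "bij (case_S5 p q)" "bij (case_S6 p q)"
proof -
  have surj: "surj f" if "p \<in> range f" "q \<in> range f" for f :: "'b \<Rightarrow> 'a"
    using that assms(1) by auto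
  show "bij (case_S1 p q)"
    using assms(2) by (intro bijI surj[OF range_eqI[of _ _ W1] range_eqI[of _ _ A1]])
      (auto intro!: injI split: S1.splits)
  show "bij (case_S2 p q)"
    using assms(2) by (intro bijI surj[OF range_eqI[of _ _ W2] range_eqI[of _ _ A2]])
      (auto intro!: injI split: S2.splits)
  show "bij (case_S3 p q)"
    using assms(2) by (intro bijI surj[OF range_eqI[of _ _ W3] range_eqI[of _ _ A3]])
      (auto intro!: injI split: S3.splits)
  show "bij (case_S4 p q)"
    using assms(2) by (intro bijI surj[OF range_eqI[of _ _ W4] range_eqI[of _ _ A4]])
      (auto intro!: injI split: S4.splits)
  show "bij (case_S5 p q)"
    using assms(2) by (intro bijI surj[OF range_eqI[of _ _ A5] range_eqI[of _ _ W5]])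
      (auto intro!: injI split: S5.splits)
  show "bij (case_S6 p q)"
    using assms(2) by (intro bijI surj[OF range_eqI[of _ _ A6] range_eqI[of _ _ W6]])
      (auto intro!: injI split: S6.splits)
qed

lemma bij_case_three:
  assumes "UNIV = {p, q, r}" "p \<noteq> q" "p \<noteq> r" "q \<noteq> r"
  shows "bij (case_S7 p q r)" "bij (case_S8 p q r)"
proof -
  have surj: "surj f" if "p \<in> range f" "q \<in> range f" "r \<in> range f" for f :: "'b \<Rightarrow> 'a"
    using that assms(1) by auto
  show "bij (case_S7 p q r)"
    using assms(2-) by (intro bijI surj[OF range_eqI[of _ _ A7] range_eqI[of _ _ B7] range_eqI[of _ _ W7]])
      (auto intro!: injI split: S7.splits)
  show "bij (case_S8 p q r)"
    using assms(2-) by (intro bijI surj[OF range_eqI[of _ _ A8] range_eqI[of _ _ B8] range_eqI[of _ _ W8]])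
      (auto intro!: injI split: S8.splits)
qed

theorem theorem4p6:
  assumes "\<forall>x :: 'a :: {semiring, finite}. x * x = x"
    and "congruence_simple TYPE('a)"
  shows "semiring_isomorphic TYPE('a) TYPE(S1) \<or> semiring_isomorphic TYPE('a) TYPE(S2) \<or>
         semiring_isomorphic TYPE('a) TYPE(S3) \<or> semiring_isomorphic TYPE('a) TYPE(S4) \<or>
         semiring_isomorphic TYPE('a) TYPE(S5) \<or> semiring_isomorphic TYPE('a) TYPE(S6) \<or>
         semiring_isomorphic TYPE('a) TYPE(S7) \<or> semiring_isomorphic TYPE('a) TYPE(S8)"
proof -
  interpret simple_idempotent_semiring "(*) :: 'a \<Rightarrow> 'a \<Rightarrow> 'a"
    using assms by (rule simple_idempotent_semiring_times)
  interpret dual: simple_idempotent_semiring "\<lambda>x y :: 'a. y * x"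
    by (rule dual)
  show ?thesis
  proof (cases "\<forall>x :: 'a. x + x = x")
    case False
    then obtain w :: 'a where double: "\<And>x. x + x = w"
      using add_idem_or_constant_double by blast
    from constant_double_cases[OF double] obtain a where
      zero: "\<And>x. w * x = w" "\<And>x. x * w = w" and a: "a \<noteq> w" "UNIV = {w, a}"
      and add: "(\<forall>x. w + x = x) \<or> (\<forall>x y. x + y = w)"
      by blast
    note a_bij = bij_case_two[OF a(2) a(1)[symmetric]]
    from add show ?thesis
    proof
      assume neutral: "\<forall>x. w + x = x"
      then have "\<forall>x. x + w = x"
        by (simp add: add.commute)
      then have "semiring_isomorphic TYPE('a) TYPE(S1)"
        using a_bij(1) neutral
        by (intro semiring_isomorphicI[of "case_S1 w a"])
          (simp, (case_tac x; case_tac y; simp add: zero double mul_idem)+)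
      then show ?thesis by blast
    next
      assume const: "\<forall>x y. x + y = w"
      then have "semiring_isomorphic TYPE('a) TYPE(S4)"
        using a_bij(4)
        by (intro semiring_isomorphicI[of "case_S4 w a"])
          (simp, (case_tac x; case_tac y; simp add: zero mul_idem)+)
      then show ?thesis by blast
    qed
  next
    case True
    then have add_idem: "x + x = x" for x :: 'a
      by blast
    show ?thesis
    proof (rule minimal_ideal_cases)
      show "finite (UNIV :: 'a set)"
        by simp
    next
      fix z :: 'a
      assume zero: "\<And>x. z * x = z" "\<And>x. x * z = z"
      from zero_cases[OF _ add_idem zero] obtain a where
        a: "a \<noteq> z" "UNIV = {z, a}" and add: "(\<forall>x. z + x = x) \<or> (\<forall>x. z + x = z)"
        by auto
      note a_bij = bij_case_two[OF a(2) a(1)[symmetric]]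
      from add show ?thesis
      proof
        assume neutral: "\<forall>x. z + x = x"
        then have "\<forall>x. x + z = x"
          by (simp add: add.commute)
        then have "semiring_isomorphic TYPE('a) TYPE(S2)"
          using a_bij(2) neutral
          by (intro semiring_isomorphicI[of "case_S2 z a"])
            (simp, (case_tac x; case_tac y; simp add: zero add_idem mul_idem)+)
        then show ?thesis by blast
      next
        assume absorb: "\<forall>x. z + x = z"
        then have "\<forall>x. x + z = z"
          by (simp add: add.commute)
        then have "semiring_isomorphic TYPE('a) TYPE(S3)"
          using a_bij(3) absorb
          by (intro semiring_isomorphicI[of "case_S3 z a"])
            (simp, (case_tac x; case_tac y; simp add: zero add_idem mul_idem)+)
        then show ?thesis by blast
      qed
    next
      fix K :: "'a set"
      assume "K \<noteq> {}" "\<forall>k\<in>K. \<forall>x. x * k \<in> K" "\<forall>k\<in>K. \<forall>x. k * x = k"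
        "\<forall>x y. (\<forall>k\<in>K. x * k = y * k) \<longrightarrow> x = y"
      from faithful_left_zeros_cases[OF add_idem this]
      obtain a w :: 'a where aw: "a \<noteq> w" "a + w = w" "\<And>x. a * x = a" "\<And>x. w * x = w"
        and cases: "UNIV = {a, w} \<or> (\<exists>b. b \<noteq> a \<and> b \<noteq> w \<and> UNIV = {a, b, w} \<and> a + b = b \<and>
          b + w = w \<and> b * a = a \<and> b * w = w)"
        by blast
      from aw(2) have wa: "w + a = w"
        by (simp add: add.commute)
      from cases show ?thesis
      proof (elim disjE exE conjE)
        assume "UNIV = {a, w}"
        then have "semiring_isomorphic TYPE('a) TYPE(S5)"
          using bij_case_two(5)[of a w] aw(1)
          by (intro semiring_isomorphicI[of "case_S5 a w"])
            (simp, (case_tac x; case_tac y; simp add: times_S5_def aw wa add_idem)+)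
        then show ?thesis by blast
      next
        fix b
        assume b: "b \<noteq> a" "b \<noteq> w" "UNIV = {a, b, w}" "a + b = b" "b + w = w" "b * a = a" "b * w = w"
        then have "b + a = b" "w + b = w"
          by (simp_all add: add.commute)
        then have "semiring_isomorphic TYPE('a) TYPE(S7)"
          using bij_case_three(1)[of a b w] b aw(1)
          by (intro semiring_isomorphicI[of "case_S7 a b w"])
            (simp, (case_tac x; case_tac y; simp add: plus_S7_def max_def less_eq_S7_def aw wa add_idem mul_idem)+)
        then show ?thesis by blast
      qed
    next
      fix K :: "'a set"
      assume "K \<noteq> {}" "\<forall>k\<in>K. \<forall>x. k * x \<in> K" "\<forall>k\<in>K. \<forall>x. x * k = k"
        "\<forall>x y. (\<forall>k\<in>K. k * x = k * y) \<longrightarrow> x = y"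
      \<comment> \<open>Right zeros are left zeros of the dual, so the opposites of
        \<open>S5\<close> and \<open>S7\<close> arise.\<close>
      from dual.faithful_left_zeros_cases[OF add_idem this]
      obtain a w :: 'a where aw: "a \<noteq> w" "a + w = w" "\<And>x. x * a = a" "\<And>x. x * w = w"
        and cases: "UNIV = {a, w} \<or> (\<exists>b. b \<noteq> a \<and> b \<noteq> w \<and> UNIV = {a, b, w} \<and> a + b = b \<and>
          b + w = w \<and> a * b = a \<and> w * b = w)"
        by blast
      from aw(2) have wa: "w + a = w"
        by (simp add: add.commute)
      from cases show ?thesis
      proof (elim disjE exE conjE)
        assume "UNIV = {a, w}"
        then have "semiring_isomorphic TYPE('a) TYPE(S6)"
          using bij_case_two(6)[of a w] aw(1)
          by (intro semiring_isomorphicI[of "case_S6 a w"])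
            (simp, (case_tac x; case_tac y; simp add: times_S6_def aw wa add_idem)+)
        then show ?thesis by blast
      next
        fix b
        assume b: "b \<noteq> a" "b \<noteq> w" "UNIV = {a, b, w}" "a + b = b" "b + w = w" "a * b = a" "w * b = w"
        then have "b + a = b" "w + b = w"
          by (simp_all add: add.commute)
        then have "semiring_isomorphic TYPE('a) TYPE(S8)"
          using bij_case_three(2)[of a b w] b aw(1)
          by (intro semiring_isomorphicI[of "case_S8 a b w"])
            (simp, (case_tac x; case_tac y; simp add: plus_S8_def max_def less_eq_S8_def aw wa add_idem mul_idem)+)
        then show ?thesis by blast
      qed
    qed
  qed
qed

end
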